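(* Let $X$ and $Y$ be Hilbert spaces and $T\in LR(X,Y)$. Then $T$ is closed if and only if $(D(T),\langle\cdot,\cdot\rangle_T)$ is a Hilbert space and $T(0)$ is closed, where $$\langle x_1,x_2\rangle_T:=\langle x_1,x_2\rangle+\langle T(x_1),T(x_2)\rangle,\qquad x_1,x_2\in D(T),$$ and $$\langle T(x_1),T(x_2)\rangle:=\langle[y_1],[y_2]\rangle,\qquad y_1\in T(x_1),\ y_2\in T(x_2),$$ the last inner product being that of the quotient space $Y/\overline{T(0)}$.
   Context: All spaces are over the same scalar field ($\mathbf R$ or $\mathbf C$). $LR(X,Y)$ is the set of all linear subspaces of $X\times Y$. For $T\in LR(X,Y)$: $D(T)$ is its domain, $T(x)=\{y\in Y:(x,y)\in T\}$. $T$ is closed if it is closed in $X\times Y$. The quotient $Y/\overline{T(0)}$, with classes $[y]=y+\overline{T(0)}$, has the inner product $\langle[y],[z]\rangle=\langle y^\perp,z^\perp\rangle$, where $y=y_0+y^\perp$, $z=z_0+z^\perp$ with $y_0,z_0\in\overline{T(0)}$ and $y^\perp,z^\perp\in\overline{T(0)}^\perp$. (The value $\langle T(x_1),T(x_2)\rangle$ does not depend on the choice of $y_j\in T(x_j)$.) *)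

theory Defs
  imports "HOL-Analysis.Analysis"
begin

(* The scalar field, R or C: both are instances, and up to isomorphism there are no others, since
   every real normed field is R or C (Gelfand-Mazur/Ostrowski), where the last axiom determines cj. *)
class real_or_complex = real_normed_field +
  fixes cj :: "'a \<Rightarrow> 'a"
  assumes cj_add: "cj (x + y) = cj x + cj y"
    and cj_mult: "cj (x * y) = cj x * cj y"
    and cj_cj: "cj (cj x) = x"
    and mult_cj_scaleR: "x * cj x = ((norm x)\<^sup>2) *\<^sub>R 1"

instantiation real :: real_or_complex
begin
definition cj_real :: "real \<Rightarrow> real" where "cj_real x = x"
instance by standard (simp_all add: cj_real_def power2_eq_square)
end

instantiation complex :: real_or_complex
begin
definition cj_complex :: "complex \<Rightarrow> complex" where "cj_complex = cnj"
instance
proof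
  show "x * cj x = ((norm x)\<^sup>2) *\<^sub>R 1" for x :: complex
    by (simp only: cj_complex_def scaleR_conv_of_real complex_norm_square mult_1_right)
qed (simp_all add: cj_complex_def)
end

lemma mult_cj: "x * cj x = of_real ((norm x)\<^sup>2)" for x :: "'k::real_or_complex"
  by (simp add: mult_cj_scaleR of_real_def)

(* Spaces are carrier sets V closed under the operations of a vector space type, because D(T)
   carries an inner product different from the one of the ambient space X. Values of ip outside V
   are irrelevant. *)
locale inner_product_space = vector_space scale
  for scale :: "'k::real_or_complex \<Rightarrow> 'v::ab_group_add \<Rightarrow> 'v" +
  fixes V :: "'v set"
    and ip :: "'v \<Rightarrow> 'v \<Rightarrow> 'k"
  assumes subspace_carrier: "subspace V"
    and ip_add_left: "\<lbrakk>x \<in> V; y \<in> V; z \<in> V\<rbrakk> \<Longrightarrow> ip (x + y) z = ip x z + ip y z"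
    and ip_scale_left: "\<lbrakk>x \<in> V; y \<in> V\<rbrakk> \<Longrightarrow> ip (scale c x) y = c * ip x y"
    and ip_commute: "\<lbrakk>x \<in> V; y \<in> V\<rbrakk> \<Longrightarrow> ip x y = cj (ip y x)"
    and ip_nonneg: "x \<in> V \<Longrightarrow> ip x x \<in> \<real>\<^sub>\<ge>\<^sub>0"
    and ip_definite: "\<lbrakk>x \<in> V; ip x x = 0\<rbrakk> \<Longrightarrow> x = 0"

(* The norm in the square root only converts the nonnegative scalar ip v v to type real. *)
definition ip_norm :: "('v \<Rightarrow> 'v \<Rightarrow> 'k::real_or_complex) \<Rightarrow> 'v \<Rightarrow> real" where
  "ip_norm ip v = sqrt (norm (ip v v))"

(* The locale Metric_space demands symmetry of the distance on the whole type, hence the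
   conditional. *)
definition ip_dist ::
    "'v set \<Rightarrow> ('v \<Rightarrow> 'v \<Rightarrow> 'k::real_or_complex) \<Rightarrow> 'v::ab_group_add \<Rightarrow> 'v \<Rightarrow> real" where
  "ip_dist V ip x y = (if x \<in> V \<and> y \<in> V then ip_norm ip (x - y) else 0)"

context inner_product_space
begin

lemma ip_zero_left: "x \<in> V \<Longrightarrow> ip 0 x = 0"
  using ip_scale_left[of x x 0] by simp

lemma cj_0: "cj (0::'k) = 0"
  using cj_add[of "0::'k" 0] by simp

lemma ip_zero_right: "x \<in> V \<Longrightarrow> ip x 0 = 0"
  using ip_commute[of x 0] ip_zero_left[of x] subspace_carrier
  by (simp add: subspace_0 cj_0)

lemma ip_add_right: "\<lbrakk>x \<in> V; y \<in> V; z \<in> V\<rbrakk> \<Longrightarrow> ip z (x + y) = ip z x + ip z y"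
  using ip_commute[of z "x + y"] ip_commute[of z x] ip_commute[of z y] subspace_carrier
  by (simp add: ip_add_left cj_add subspace_add)

lemma ip_scale_right: "\<lbrakk>x \<in> V; y \<in> V\<rbrakk> \<Longrightarrow> ip y (scale c x) = cj c * ip y x"
  using ip_commute[of y "scale c x"] ip_commute[of y x] subspace_carrier
  by (simp add: ip_scale_left cj_mult subspace_scale)

lemma ip_self: "x \<in> V \<Longrightarrow> ip x x = of_real ((ip_norm ip x)\<^sup>2)"
  using ip_nonneg[of x] by (auto simp: ip_norm_def nonneg_Reals_def)

lemma norm_cj: "norm (cj (a::'k)) = norm a"
proof (cases "a = 0")
  case False
  have "norm a * norm (cj a) = norm a * norm a"
    using arg_cong[OF mult_cj[of a], of norm] by (simp add: norm_mult power2_eq_square)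
  with False show ?thesis by simp
qed (simp add: cj_0)

lemma ip_Cauchy_Schwarz:
  assumes x: "x \<in> V" and y: "y \<in> V"
  shows "norm (ip x y) \<le> ip_norm ip x * ip_norm ip y"
proof (cases "ip_norm ip y = 0")
  case True
  then have "y = 0" using ip_self[OF y] ip_definite[OF y] by simp
  then show ?thesis using ip_zero_right[OF x] True by simp
next
  case False
  let ?n = "(ip_norm ip y)\<^sup>2"
  define t where "t = - (ip x y / of_real ?n)"
  let ?w = "x + scale t y"
  have ty: "scale t y \<in> V" and w: "?w \<in> V"
    using x y subspace_carrier by (auto intro: subspace_add subspace_scale)
  have n0: "(of_real ?n :: 'k) \<noteq> 0" using False by simp
  have "ip ?w y = ip x y + t * of_real ?n"
    using x y ty by (simp only: ip_add_left ip_scale_left ip_self)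
  then have z: "ip ?w y = 0"
    using n0 by (simp add: t_def)
  have "ip ?w ?w = ip ?w x"
    using x y ty w z by (simp add: ip_add_right ip_scale_right)
  also have "\<dots> = of_real ((ip_norm ip x)\<^sup>2) + t * ip y x"
    using x y ty by (simp add: ip_add_left ip_scale_left ip_self)
  also have "t * ip y x = - (of_real ((norm (ip x y))\<^sup>2) / of_real ?n)"
    using ip_commute[OF y x] mult_cj[of "ip x y"] by (simp add: t_def)
  finally have "(of_real ((ip_norm ip ?w)\<^sup>2) :: 'k)
      = of_real ((ip_norm ip x)\<^sup>2 - (norm (ip x y))\<^sup>2 / ?n)"
    using ip_self[OF w] by simp
  then have "(ip_norm ip ?w)\<^sup>2 = (ip_norm ip x)\<^sup>2 - (norm (ip x y))\<^sup>2 / ?n"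
    by (simp only: of_real_eq_iff)
  then have "(norm (ip x y))\<^sup>2 / ?n \<le> (ip_norm ip x)\<^sup>2"
    using zero_le_power2[of "ip_norm ip ?w"] by linarith
  then have "(norm (ip x y))\<^sup>2 \<le> (ip_norm ip x * ip_norm ip y)\<^sup>2"
    using False by (simp add: field_simps)
  then show ?thesis
    by (rule power2_le_imp_le) (simp add: ip_norm_def)
qed

lemma ip_norm_triangle:
  assumes x: "x \<in> V" and y: "y \<in> V"
  shows "ip_norm ip (x + y) \<le> ip_norm ip x + ip_norm ip y"
proof -
  have xy: "x + y \<in> V" using x y subspace_carrier by (simp add: subspace_add)
  have nn: "ip_norm ip v \<ge> 0" and ip_self2: "norm (ip v v) = (ip_norm ip v)\<^sup>2" for v
    by (simp_all add: ip_norm_def)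
  have "(ip_norm ip (x + y))\<^sup>2 = norm (ip (x + y) (x + y))"
    by (simp add: ip_norm_def)
  also have "ip (x + y) (x + y) = ip x x + ip y y + ip x y + ip y x"
    using x y xy by (simp add: ip_add_left ip_add_right)
  also have "norm \<dots> \<le> norm (ip x x) + norm (ip y y) + norm (ip x y) + norm (ip y x)"
    by (intro norm_triangle_mono order_refl)
  also have "\<dots> \<le> (ip_norm ip x + ip_norm ip y)\<^sup>2"
    using ip_Cauchy_Schwarz[OF x y] ip_Cauchy_Schwarz[OF y x]
      ip_self2[of x] ip_self2[of y]
    by (simp add: power2_sum algebra_simps)
  finally show ?thesis
    by (rule power2_le_imp_le) (simp add: nn)
qed

lemma Metric_space_ip: "Metric_space V (ip_dist V ip)"
proof
  show "0 \<le> ip_dist V ip x y" for x y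
    by (simp add: ip_dist_def ip_norm_def)
  show "ip_dist V ip x y = ip_dist V ip y x" for x y
  proof (cases "x \<in> V \<and> y \<in> V")
    case True
    then have d: "x - y \<in> V" using subspace_carrier by (simp add: subspace_diff)
    have "y - x = scale (-1) (x - y)" by simp
    then have "ip (y - x) (y - x) = ((-1) * cj (-1)) * ip (x - y) (x - y)"
      using d subspace_scale[OF subspace_carrier d, of "-1"]
      by (simp only: ip_scale_left ip_scale_right mult.assoc mult.left_commute)
    moreover have "(-1) * cj (-1) = (1::'k)"
      using mult_cj[of "-1::'k"] by simp
    ultimately have "ip (y - x) (y - x) = ip (x - y) (x - y)"
      by (simp only: mult_1)
    with True show ?thesis by (simp add: ip_dist_def ip_norm_def)
  qed (auto simp: ip_dist_def)
  show "ip_dist V ip x y = 0 \<longleftrightarrow> x = y" if xy: "x \<in> V" "y \<in> V" for x y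
  proof -
    have d: "x - y \<in> V" using xy subspace_carrier by (simp add: subspace_diff)
    have "ip 0 0 = 0" using ip_zero_left[of 0] subspace_0[OF subspace_carrier] by simp
    then show ?thesis using xy ip_definite[OF d] by (auto simp: ip_dist_def ip_norm_def)
  qed
  show "ip_dist V ip x z \<le> ip_dist V ip x y + ip_dist V ip y z"
    if xyz: "x \<in> V" "y \<in> V" "z \<in> V" for x y z
  proof -
    have "ip_norm ip ((x - y) + (y - z)) \<le> ip_norm ip (x - y) + ip_norm ip (y - z)"
      using xyz by (intro ip_norm_triangle subspace_diff subspace_carrier)
    moreover have "(x - y) + (y - z) = x - z" by simp
    ultimately show ?thesis using xyz by (simp add: ip_dist_def)
  qed
qed

end

definition ip_topology ::
    "'v set \<Rightarrow> ('v \<Rightarrow> 'v \<Rightarrow> 'k::real_or_complex) \<Rightarrow> 'v::ab_group_add topology" where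
  "ip_topology V ip = Metric_space.mtopology V (ip_dist V ip)"

locale hilbert_space = inner_product_space +
  assumes complete: "Metric_space.mcomplete V (ip_dist V ip)"

definition linear_relations ::
    "('k::field \<Rightarrow> 'a::ab_group_add \<Rightarrow> 'a) \<Rightarrow> 'a set \<Rightarrow>
     ('k \<Rightarrow> 'b::ab_group_add \<Rightarrow> 'b) \<Rightarrow> 'b set \<Rightarrow> ('a \<times> 'b) set set" where
  "linear_relations sX X sY Y =
     {T. T \<subseteq> X \<times> Y \<and> module.subspace (module_prod.scale sX sY) T}"

definition orth_complement ::
    "'v set \<Rightarrow> ('v \<Rightarrow> 'v \<Rightarrow> 'k::real_or_complex) \<Rightarrow> 'v set \<Rightarrow> 'v set" where
  "orth_complement V ip M = {v \<in> V. \<forall>m\<in>M. ip v m = 0}"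

(* The component y_perp in y = y_0 + y_perp, for a closed subspace M of a Hilbert space V. *)
definition perp_part ::
    "'v set \<Rightarrow> ('v \<Rightarrow> 'v \<Rightarrow> 'k::real_or_complex) \<Rightarrow> 'v set \<Rightarrow> 'v::ab_group_add \<Rightarrow> 'v" where
  "perp_part V ip M y = (THE w. w \<in> orth_complement V ip M \<and> y - w \<in> M)"

definition coset :: "'v set \<Rightarrow> 'v::ab_group_add \<Rightarrow> 'v set" where
  "coset M y = (\<lambda>m. y + m) ` M"

definition quotient_ip ::
    "'v set \<Rightarrow> ('v \<Rightarrow> 'v \<Rightarrow> 'k::real_or_complex) \<Rightarrow> 'v set \<Rightarrow>
     'v::ab_group_add set \<Rightarrow> 'v set \<Rightarrow> 'k" where
  "quotient_ip V ip M A B =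
     (THE c. \<exists>y\<in>V. \<exists>z\<in>V. A = coset M y \<and> B = coset M z \<and>
        c = ip (perp_part V ip M y) (perp_part V ip M z))"

(* T `` {x} is the set T(x). *)
definition relation_ip ::
    "'b set \<Rightarrow> ('b \<Rightarrow> 'b \<Rightarrow> 'k::real_or_complex) \<Rightarrow>
     ('a::zero \<times> 'b::ab_group_add) set \<Rightarrow> 'a \<Rightarrow> 'a \<Rightarrow> 'k" where
  "relation_ip Y ipY T x1 x2 =
     (let M = ip_topology Y ipY closure_of (T `` {0})
      in THE c. \<exists>y1 \<in> T `` {x1}. \<exists>y2 \<in> T `` {x2}.
           c = quotient_ip Y ipY M (coset M y1) (coset M y2))"

definition graph_ip ::
    "('a \<Rightarrow> 'a \<Rightarrow> 'k::real_or_complex) \<Rightarrow> 'b set \<Rightarrow> ('b \<Rightarrow> 'b \<Rightarrow> 'k) \<Rightarrow>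
     ('a::zero \<times> 'b::ab_group_add) set \<Rightarrow> 'a \<Rightarrow> 'a \<Rightarrow> 'k" where
  "graph_ip ipX Y ipY T x1 x2 = ipX x1 x2 + relation_ip Y ipY T x1 x2"

end

theory Submission
  imports Defs
begin

text \<open>If \<open>T\<close> is closed, so is \<open>T(0)\<close>, since it is the slice of \<open>T\<close> over \<open>0\<close>. It
  remains to show, for closed \<open>T(0)\<close>, that \<open>T\<close> is closed iff \<open>D(T)\<close> is complete in the graph
  norm.

  By the projection theorem, every \<open>T(x)\<close>, a coset of \<open>T(0)\<close>, contains exactly one element \<open>S(x)\<close>
  orthogonal to \<open>T(0)\<close>. This makes \<open>S\<close>, the operator part of \<open>T\<close>, a linear map on \<open>D(T)\<close> with
  \<open>T(x) = S(x) + T(0)\<close>. The inner product of the cosets \<open>T(x\<^sub>1)\<close> and \<open>T(x\<^sub>2)\<close> is that of \<open>S(x\<^sub>1)\<close> and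
  \<open>S(x\<^sub>2)\<close>, so the graph norm satisfies \<open>\<parallel>x\<parallel>\<^sub>T\<^sup>2 = \<parallel>x\<parallel>\<^sup>2 + \<parallel>S(x)\<parallel>\<^sup>2\<close>. Convergence of \<open>x\<^sub>n\<close> in
  this norm is therefore convergence of \<open>x\<^sub>n\<close> in \<open>X\<close> and of \<open>S(x\<^sub>n)\<close> to the value of \<open>S\<close> at the
  limit in \<open>Y\<close> (\<open>limitin_graph\<close>), and similarly for Cauchy sequences (\<open>MCauchy_graph\<close>).

  Both implications then rest on one estimate: \<open>S(x)\<close> is the shortest element of \<open>T(x)\<close>
  (\<open>operator_part_norm_le\<close>). In \<open>closed_imp_hilbert\<close>, the limits of \<open>x\<^sub>n\<close> and \<open>S(x\<^sub>n)\<close> form a pair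
  \<open>(x, w)\<close> in \<open>T\<close>, and the estimate, applied to \<open>(x\<^sub>n - x, S(x\<^sub>n) - w)\<close>, gives
  \<open>\<parallel>S(x\<^sub>n) - S(x)\<parallel> \<le> \<parallel>S(x\<^sub>n) - w\<parallel>\<close>. In \<open>hilbert_imp_closed\<close>, it bounds \<open>\<parallel>S(x\<^sub>m) - S(x\<^sub>n)\<parallel>\<close> by
  \<open>\<parallel>y\<^sub>m - y\<^sub>n\<parallel>\<close> for convergent \<open>(x\<^sub>n, y\<^sub>n)\<close> in \<open>T\<close>, so that \<open>x\<^sub>n\<close> is Cauchy in the graph norm and the
  limit \<open>x\<close> is in \<open>D(T)\<close>; then \<open>y - S(x)\<close>, being the limit of \<open>y\<^sub>n - S(x\<^sub>n)\<close>, lies in the closed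
  space \<open>T(0)\<close>.\<close>

section \<open>Sequences and norms in an inner product space\<close>

lemma Cauchy_estimate_mono:
  fixes f g :: "nat \<Rightarrow> nat \<Rightarrow> real"
  assumes f: "\<forall>\<epsilon>>0. \<exists>N. \<forall>m n. N \<le> m \<longrightarrow> N \<le> n \<longrightarrow> f m n < \<epsilon>"
    and le: "\<And>m n. g m n \<le> f m n"
  shows "\<forall>\<epsilon>>0. \<exists>N. \<forall>m n. N \<le> m \<longrightarrow> N \<le> n \<longrightarrow> g m n < \<epsilon>"
proof (intro allI impI)
  fix \<epsilon> :: real assume "0 < \<epsilon>"
  with f obtain N where N: "\<And>m n. N \<le> m \<Longrightarrow> N \<le> n \<Longrightarrow> f m n < \<epsilon>" by blast
  have "\<forall>m n. N \<le> m \<longrightarrow> N \<le> n \<longrightarrow> g m n < \<epsilon>"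
    using le_less_trans[OF le N] by simp
  then show "\<exists>N. \<forall>m n. N \<le> m \<longrightarrow> N \<le> n \<longrightarrow> g m n < \<epsilon>" ..
qed

context inner_product_space
begin

sublocale metric: Metric_space V "ip_dist V ip"
  by (rule Metric_space_ip)

lemma ip_norm_nonneg: "0 \<le> ip_norm ip v"
  by (simp add: ip_norm_def)

lemma ip_norm_eq_0: "v \<in> V \<Longrightarrow> ip_norm ip v = 0 \<Longrightarrow> v = 0"
  using ip_self[of v] ip_definite[of v] by simp

lemma ip_norm_scale:
  assumes "v \<in> V"
  shows "ip_norm ip (scale c v) = norm c * ip_norm ip v"
proof -
  have "ip (scale c v) (scale c v) = c * cj c * ip v v"
    using assms subspace_scale[OF subspace_carrier assms, of c]
    by (simp add: ip_scale_left ip_scale_right)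
  then have "norm (ip (scale c v) (scale c v)) = (norm c)\<^sup>2 * norm (ip v v)"
    by (simp add: norm_mult norm_cj power2_eq_square)
  then show ?thesis
    by (simp add: ip_norm_def real_sqrt_mult)
qed

lemma ip_norm_minus_commute:
  assumes "x \<in> V" "y \<in> V"
  shows "ip_norm ip (x - y) = ip_norm ip (y - x)"
  using ip_norm_scale[of "y - x" "-1"] assms subspace_carrier
  by (simp add: subspace_diff)

lemma ip_minus_left:
  assumes "x \<in> V" "y \<in> V"
  shows "ip (- x) y = - ip x y"
  using ip_scale_left[OF assms, of "-1"] by simp

lemma ip_diff_left:
  assumes "x \<in> V" "y \<in> V" "z \<in> V"
  shows "ip (x - y) z = ip x z - ip y z"
  using ip_add_left[of x "- y" z] assms subspace_carrier
  by (simp add: subspace_neg ip_minus_left)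

lemma ip_minus_right:
  assumes "x \<in> V" "y \<in> V"
  shows "ip y (- x) = - ip y x"
proof -
  have "ip y x + ip y (- x) = 0"
    using ip_add_right[of x "- x" y] assms subspace_carrier
    by (simp add: subspace_neg ip_zero_right)
  then show ?thesis by (simp add: eq_neg_iff_add_eq_0 add.commute)
qed

lemma ip_diff_right:
  assumes "x \<in> V" "y \<in> V" "z \<in> V"
  shows "ip z (x - y) = ip z x - ip z y"
  using ip_add_right[of x "- y" z] assms subspace_carrier
  by (simp add: subspace_neg ip_minus_right)

lemma ip_eq_0_commute:
  assumes "x \<in> V" "y \<in> V" "ip x y = 0"
  shows "ip y x = 0"
  using ip_commute[of y x] assms cj_0 by simp

lemma Pythagoras:
  assumes "x \<in> V" "y \<in> V" "ip x y = 0"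
  shows "(ip_norm ip (x + y))\<^sup>2 = (ip_norm ip x)\<^sup>2 + (ip_norm ip y)\<^sup>2"
proof -
  have xy: "x + y \<in> V" using assms subspace_carrier by (simp add: subspace_add)
  have "ip (x + y) (x + y) = ip x x + ip y y"
    using assms xy ip_eq_0_commute[OF assms] by (simp add: ip_add_left ip_add_right)
  then have "(of_real ((ip_norm ip (x + y))\<^sup>2) :: 'k)
      = of_real ((ip_norm ip x)\<^sup>2 + (ip_norm ip y)\<^sup>2)"
    by (simp only: ip_self assms xy of_real_add)
  then show ?thesis by (simp only: of_real_eq_iff)
qed

lemma parallelogram:
  assumes "x \<in> V" "y \<in> V"
  shows "(ip_norm ip (x + y))\<^sup>2 + (ip_norm ip (x - y))\<^sup>2
    = 2 * (ip_norm ip x)\<^sup>2 + 2 * (ip_norm ip y)\<^sup>2"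
proof -
  have xy: "x + y \<in> V" "x - y \<in> V"
    using assms subspace_carrier by (auto simp: subspace_add subspace_diff)
  have "ip (x + y) (x + y) + ip (x - y) (x - y) = (ip x x + ip x x) + (ip y y + ip y y)"
    using assms xy by (simp add: ip_add_left ip_add_right ip_diff_left ip_diff_right)
  then have "(of_real ((ip_norm ip (x + y))\<^sup>2 + (ip_norm ip (x - y))\<^sup>2) :: 'k)
      = of_real (((ip_norm ip x)\<^sup>2 + (ip_norm ip x)\<^sup>2) + ((ip_norm ip y)\<^sup>2 + (ip_norm ip y)\<^sup>2))"
    by (simp only: ip_self assms xy of_real_add)
  then show ?thesis by (simp only: of_real_eq_iff)
qed

lemma limitin_ip_topology:
  "limitin (ip_topology V ip) \<sigma> l F \<longleftrightarrow>
    l \<in> V \<and> (\<forall>\<^sub>F n in F. \<sigma> n \<in> V) \<and> ((\<lambda>n. ip_norm ip (\<sigma> n - l)) \<longlongrightarrow> 0) F"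
proof -
  have "((\<lambda>n. ip_dist V ip (\<sigma> n) l) \<longlongrightarrow> 0) F \<longleftrightarrow> ((\<lambda>n. ip_norm ip (\<sigma> n - l)) \<longlongrightarrow> 0) F"
    if "l \<in> V" "\<forall>\<^sub>F n in F. \<sigma> n \<in> V"
    using that by (intro tendsto_cong) (auto simp: ip_dist_def elim: eventually_mono)
  then show ?thesis
    by (auto simp: ip_topology_def metric.limitin_metric_dist_null)
qed

lemma closedin_ip_topology:
  "closedin (ip_topology V ip) S \<longleftrightarrow> S \<subseteq> V \<and>
    (\<forall>\<sigma> l. range \<sigma> \<subseteq> S \<and> limitin (ip_topology V ip) \<sigma> l sequentially \<longrightarrow> l \<in> S)"
  unfolding ip_topology_def by (rule metric.metric_closedin_iff_sequentially_closed)

lemma MCauchy_ip: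
  "metric.MCauchy \<sigma> \<longleftrightarrow> range \<sigma> \<subseteq> V \<and>
    (\<forall>\<epsilon>>0. \<exists>N. \<forall>m n. N \<le> m \<longrightarrow> N \<le> n \<longrightarrow> ip_norm ip (\<sigma> m - \<sigma> n) < \<epsilon>)"
  unfolding metric.MCauchy_def by (auto simp: ip_dist_def image_subset_iff)

end

section \<open>Orthogonal projection onto a closed subspace\<close>

context inner_product_space
begin

lemma orth_complement_subspace:
  assumes "M \<subseteq> V"
  shows "subspace (orth_complement V ip M)"
  using assms subspace_carrier
  by (auto simp: subspace_def orth_complement_def ip_zero_left ip_add_left ip_scale_left)

lemma orth_complement_disjoint:
  assumes "v \<in> M" "v \<in> orth_complement V ip M"
  shows "v = 0"
  using assms ip_definite by (auto simp: orth_complement_def)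

text \<open>The two components of \<open>y\<close> are unique because the difference of two candidates lies both
  in \<open>M\<close> and in its complement.\<close>

lemma perp_part_eqI:
  assumes "M \<subseteq> V" "subspace M" "w \<in> orth_complement V ip M" "y - w \<in> M"
  shows "perp_part V ip M y = w"
  unfolding perp_part_def
proof (rule the_equality)
  fix w' assume w': "w' \<in> orth_complement V ip M \<and> y - w' \<in> M"
  have "(y - w') - (y - w) \<in> M"
    by (rule subspace_diff[OF assms(2)]) (use w' assms(4) in auto)
  then have "w - w' \<in> M" by simp
  moreover have "w - w' \<in> orth_complement V ip M"
    by (rule subspace_diff[OF orth_complement_subspace[OF assms(1)]]) (use w' assms(3) in auto)
  ultimately show "w' = w" using orth_complement_disjoint by force
qed (use assms in auto)

text \<open>If \<open>w\<close> cannot be shortened by subtracting elements of \<open>M\<close>, it has no component along any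
  \<open>z \<in> M\<close>: by Pythagoras, removing such a component would shorten it.\<close>

lemma shortest_imp_orthogonal:
  assumes M: "M \<subseteq> V" "subspace M" and w: "w \<in> V"
    and shortest: "\<And>m. m \<in> M \<Longrightarrow> ip_norm ip w \<le> ip_norm ip (w - m)"
  shows "w \<in> orth_complement V ip M"
proof -
  have "ip w z = 0" if z: "z \<in> M" for z
  proof (cases "z = 0")
    case True
    then show ?thesis using w by (simp add: ip_zero_right)
  next
    case False
    have zV: "z \<in> V" using z M by auto
    have nz: "ip z z \<noteq> 0" using False ip_definite[OF zV] by auto
    \<comment> \<open>the coefficient for which \<open>scale t z\<close> is the component of \<open>w\<close> along \<open>z\<close>\<close>
    define t where "t = ip w z / ip z z"
    have tz: "scale t z \<in> M" and tzV: "scale t z \<in> V"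
      using z M subspace_scale by auto
    have wtz: "w - scale t z \<in> V"
      using w tzV subspace_carrier by (simp add: subspace_diff)
    have "ip (w - scale t z) z = 0"
      using w tzV zV nz by (simp add: ip_diff_left ip_scale_left t_def)
    then have "ip (w - scale t z) (scale t z) = 0"
      using wtz zV by (simp add: ip_scale_right)
    from Pythagoras[OF wtz tzV this]
    have "(ip_norm ip w)\<^sup>2 = (ip_norm ip (w - scale t z))\<^sup>2 + (ip_norm ip (scale t z))\<^sup>2"
      by simp
    moreover have "(ip_norm ip w)\<^sup>2 \<le> (ip_norm ip (w - scale t z))\<^sup>2"
      using shortest[OF tz] ip_norm_nonneg by (intro power_mono)
    ultimately have "(ip_norm ip (scale t z))\<^sup>2 \<le> 0" by linarith
    then have "scale t z = 0" using ip_norm_eq_0[OF tzV] by simp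
    then have "t = 0" using False by simp
    then show ?thesis using nz by (simp add: t_def)
  qed
  then show ?thesis using w by (auto simp: orth_complement_def)
qed

end

context hilbert_space
begin

text \<open>A sequence in \<open>M\<close> whose distances to \<open>y\<close> approach the infimum is Cauchy by the
  parallelogram law, as midpoints of its members lie in \<open>M\<close> and are not closer to \<open>y\<close> than the
  infimum. The difference of \<open>y\<close> and its limit is shortest, hence orthogonal to \<open>M\<close>.\<close>

lemma projection_exists:
  assumes closed: "closedin (ip_topology V ip) M" and sub: "subspace M" and y: "y \<in> V"
  shows "\<exists>w. w \<in> orth_complement V ip M \<and> y - w \<in> M"
proof -
  have MV: "M \<subseteq> V" using closed closedin_ip_topology by blast
  note V_sub = subspace_carrier
  have inV: "y - m \<in> V" if "m \<in> M" for m
    using that y MV V_sub subspace_diff by blast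
  define D where "D = (\<lambda>m. (ip_norm ip (y - m))\<^sup>2) ` M"
  define \<delta> where "\<delta> = Inf D"
  have D_ne: "D \<noteq> {}" using subspace_0[OF sub] by (auto simp: D_def)
  have "bdd_below D" by (rule bdd_belowI[of _ 0]) (auto simp: D_def)
  then have \<delta>_le: "\<delta> \<le> (ip_norm ip (y - m))\<^sup>2" if "m \<in> M" for m
    unfolding \<delta>_def using that by (intro cInf_lower) (auto simp: D_def)
  have "\<exists>m\<in>M. (ip_norm ip (y - m))\<^sup>2 < \<delta> + inverse (real (Suc n))" for n
    using cInf_lessD[OF D_ne, of "\<delta> + inverse (real (Suc n))"] by (auto simp: D_def \<delta>_def)
  then obtain \<sigma> where \<sigma>M: "\<sigma> n \<in> M"
    and \<sigma>: "(ip_norm ip (y - \<sigma> n))\<^sup>2 < \<delta> + inverse (real (Suc n))" for n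
    by metis
  have dist: "(ip_norm ip (\<sigma> i - \<sigma> j))\<^sup>2
      \<le> 2 * inverse (real (Suc i)) + 2 * inverse (real (Suc j))" for i j
  proof -
    let ?a = "y - \<sigma> i" and ?b = "y - \<sigma> j"
    define c where "c = scale (1/2) (\<sigma> i + \<sigma> j)"
    have c: "c \<in> M" using \<sigma>M sub by (auto simp: c_def intro: subspace_scale subspace_add)
    have two: "scale 2 v = v + v" for v
      using scale_left_distrib[of 1 1 v] by simp
    have "scale 2 c = \<sigma> i + \<sigma> j" by (simp add: c_def)
    then have "?a + ?b = scale 2 (y - c)"
      by (simp add: scale_right_diff_distrib two algebra_simps)
    then have "(ip_norm ip (?a + ?b))\<^sup>2 = 4 * (ip_norm ip (y - c))\<^sup>2"
      using ip_norm_scale[OF inV[OF c], of 2] by (simp add: power_mult_distrib)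
    moreover have "(ip_norm ip (?a - ?b))\<^sup>2 = (ip_norm ip (\<sigma> i - \<sigma> j))\<^sup>2"
      using ip_norm_minus_commute[OF subsetD[OF MV \<sigma>M[of j]] subsetD[OF MV \<sigma>M[of i]]]
      by simp
    ultimately show ?thesis
      using parallelogram[OF inV[OF \<sigma>M[of i]] inV[OF \<sigma>M[of j]]] \<sigma>[of i] \<sigma>[of j] \<delta>_le[OF c]
      by linarith
  qed
  have "metric.MCauchy \<sigma>"
    unfolding MCauchy_ip
  proof (intro conjI allI impI)
    show "range \<sigma> \<subseteq> V" using \<sigma>M MV by auto
    fix \<epsilon> :: real assume \<epsilon>: "0 < \<epsilon>"
    obtain N where N: "inverse (real (Suc N)) < \<epsilon>\<^sup>2 / 4"
      using reals_Archimedean[of "\<epsilon>\<^sup>2 / 4"] \<epsilon> by auto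
    have "ip_norm ip (\<sigma> m - \<sigma> n) < \<epsilon>" if "N \<le> m" "N \<le> n" for m n
    proof -
      have "inverse (real (Suc m)) \<le> inverse (real (Suc N))"
        "inverse (real (Suc n)) \<le> inverse (real (Suc N))"
        using that by (auto intro: le_imp_inverse_le)
      then have "(ip_norm ip (\<sigma> m - \<sigma> n))\<^sup>2 < \<epsilon>\<^sup>2"
        using dist[of m n] N by linarith
      then show ?thesis by (rule power2_less_imp_less) (use \<epsilon> in simp)
    qed
    then show "\<exists>N. \<forall>m n. N \<le> m \<longrightarrow> N \<le> n \<longrightarrow> ip_norm ip (\<sigma> m - \<sigma> n) < \<epsilon>" by blast
  qed
  then obtain l where lim: "limitin (ip_topology V ip) \<sigma> l sequentially"
    using complete unfolding metric.mcomplete_def ip_topology_def by blast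
  then have lM: "l \<in> M" using closed \<sigma>M closedin_ip_topology by blast
  have lim0: "(\<lambda>n. ip_norm ip (\<sigma> n - l)) \<longlonglongrightarrow> 0"
    using lim by (simp add: limitin_ip_topology)
  have "(\<lambda>n. sqrt (\<delta> + inverse (real (Suc n))) + ip_norm ip (\<sigma> n - l)) \<longlonglongrightarrow> sqrt (\<delta> + 0) + 0"
    by (intro tendsto_intros LIMSEQ_inverse_real_of_nat lim0)
  moreover have "ip_norm ip (y - l)
      \<le> sqrt (\<delta> + inverse (real (Suc n))) + ip_norm ip (\<sigma> n - l)" for n
  proof -
    have "\<sigma> n - l \<in> V" using \<sigma>M[of n] lM sub MV subspace_diff by blast
    then have "ip_norm ip ((y - \<sigma> n) + (\<sigma> n - l)) \<le> ip_norm ip (y - \<sigma> n) + ip_norm ip (\<sigma> n - l)"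
      by (intro ip_norm_triangle inV \<sigma>M)
    moreover have "ip_norm ip (y - \<sigma> n) \<le> sqrt (\<delta> + inverse (real (Suc n)))"
      using \<sigma>[of n] by (intro real_le_rsqrt) simp
    ultimately show ?thesis by simp
  qed
  ultimately have le_sqrt: "ip_norm ip (y - l) \<le> sqrt \<delta>"
    by (intro LIMSEQ_le_const[where a = "ip_norm ip (y - l)"]) auto
  have "y - l \<in> orth_complement V ip M"
  proof (rule shortest_imp_orthogonal[OF MV sub inV[OF lM]])
    fix m assume "m \<in> M"
    then have lm: "l + m \<in> M" using lM sub subspace_add by blast
    have "sqrt \<delta> \<le> ip_norm ip (y - (l + m))"
      using \<delta>_le[OF lm] ip_norm_nonneg by (intro real_le_lsqrt) auto
    then show "ip_norm ip (y - l) \<le> ip_norm ip (y - l - m)"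
      using le_sqrt by (simp add: diff_diff_add)
  qed
  then show ?thesis using lM by (intro exI[of _ "y - l"]) simp
qed

lemma perp_part:
  assumes "closedin (ip_topology V ip) M" "subspace M" "y \<in> V"
  shows "perp_part V ip M y \<in> orth_complement V ip M" "y - perp_part V ip M y \<in> M"
proof -
  have "M \<subseteq> V" using assms(1) closedin_ip_topology by blast
  moreover obtain w where w: "w \<in> orth_complement V ip M" "y - w \<in> M"
    using projection_exists[OF assms] by blast
  ultimately have "perp_part V ip M y = w" using assms(2) by (intro perp_part_eqI)
  with w show "perp_part V ip M y \<in> orth_complement V ip M" "y - perp_part V ip M y \<in> M"
    by simp_all
qed

text \<open>The definite description in \<open>quotient_ip\<close> denotes because representatives of one coset differ
  by an element of \<open>M\<close> and so have the same component orthogonal to \<open>M\<close>.\<close>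

lemma quotient_ip_coset:
  assumes closed: "closedin (ip_topology V ip) M" and sub: "subspace M"
    and y: "y \<in> V" and z: "z \<in> V"
  shows "quotient_ip V ip M (coset M y) (coset M z)
    = ip (perp_part V ip M y) (perp_part V ip M z)"
proof -
  have MV: "M \<subseteq> V" using closed closedin_ip_topology by blast
  have eq: "perp_part V ip M a = perp_part V ip M b"
    if a: "a \<in> V" and b: "b \<in> V" and ab: "coset M a = coset M b" for a b
  proof (rule perp_part_eqI[OF MV sub perp_part(1)[OF closed sub b]])
    have "a \<in> coset M a"
      unfolding coset_def using subspace_0[OF sub] by (intro image_eqI[of _ _ 0]) auto
    then obtain m where m: "m \<in> M" "a = b + m" unfolding ab by (auto simp: coset_def)
    have "(b - perp_part V ip M b) + m \<in> M"
      using perp_part(2)[OF closed sub b] m sub subspace_add by blast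
    then show "a - perp_part V ip M b \<in> M" by (simp add: m(2) algebra_simps)
  qed
  show ?thesis
    unfolding quotient_ip_def
    by (rule the_equality) (use y z eq in metis)+
qed

end

section \<open>The operator part of a linear relation\<close>

locale hilbert_relation =
  dom: hilbert_space sX X ipX + cod: hilbert_space sY Y ipY
  for sX :: "'k::real_or_complex \<Rightarrow> 'a::ab_group_add \<Rightarrow> 'a" and X ipX
    and sY :: "'k \<Rightarrow> 'b::ab_group_add \<Rightarrow> 'b" and Y ipY +
  fixes T :: "('a \<times> 'b) set"
  assumes relation: "T \<in> linear_relations sX X sY Y"
begin

lemma T_in: assumes "(x, y) \<in> T" shows "x \<in> X" "y \<in> Y"
  using assms relation by (auto simp: linear_relations_def)

lemma T_zero: "(0, 0) \<in> T"
  and T_add: "(x, y) \<in> T \<Longrightarrow> (x', y') \<in> T \<Longrightarrow> (x + x', y + y') \<in> T"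
  and T_scale: "(x, y) \<in> T \<Longrightarrow> (sX c x, sY c y) \<in> T"
proof -
  interpret p: module_prod sX sY by unfold_locales
  have T: "p.p.subspace T" using relation by (simp add: linear_relations_def)
  show "(0, 0) \<in> T" using p.p.subspace_0[OF T] by (simp add: zero_prod_def)
  show "(x + x', y + y') \<in> T" if "(x, y) \<in> T" "(x', y') \<in> T"
    using p.p.subspace_add[OF T that] by simp
  show "(sX c x, sY c y) \<in> T" if "(x, y) \<in> T"
    using p.p.subspace_scale[OF T that] by (simp add: p.scale_prod)
qed

lemma T_diff: "(x, y) \<in> T \<Longrightarrow> (x', y') \<in> T \<Longrightarrow> (x - x', y - y') \<in> T"
  using T_add[of x y "- x'" "- y'"] T_scale[of x' y' "-1"] by simp

lemma Domain_subspace: "dom.subspace (Domain T)"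
  unfolding dom.subspace_def using T_zero T_add T_scale by (blast dest: DomainI)

lemma multivalued_part_subspace: "cod.subspace (T `` {0})"
  unfolding cod.subspace_def using T_zero T_add[of 0 _ 0] T_scale[of 0] by auto

text \<open>The product topology is metrizable, so sequences detect closedness, and they converge
  componentwise.\<close>

lemma closedin_relation:
  "closedin (prod_topology (ip_topology X ipX) (ip_topology Y ipY)) T \<longleftrightarrow>
    (\<forall>\<xi> \<eta> x y. (\<forall>n. (\<xi> n, \<eta> n) \<in> T) \<and> limitin (ip_topology X ipX) \<xi> x sequentially \<and>
      limitin (ip_topology Y ipY) \<eta> y sequentially \<longrightarrow> (x, y) \<in> T)"
    (is "_ \<longleftrightarrow> ?R")
proof -
  interpret P: Metric_space12 X "ip_dist X ipX" Y "ip_dist Y ipY"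
    by unfold_locales
  have top: "prod_topology (ip_topology X ipX) (ip_topology Y ipY) = P.Prod_metric.mtopology"
    unfolding ip_topology_def by (rule P.mtopology_prod_metric[symmetric])
  have TXY: "T \<subseteq> X \<times> Y" using relation by (simp add: linear_relations_def)
  have "closedin P.Prod_metric.mtopology T \<longleftrightarrow>
      (\<forall>\<sigma> l. range \<sigma> \<subseteq> T \<and> limitin P.Prod_metric.mtopology \<sigma> l sequentially \<longrightarrow> l \<in> T)"
    using P.Prod_metric.metric_closedin_iff_sequentially_closed TXY by simp
  also have "\<dots> \<longleftrightarrow> (\<forall>\<sigma> x y. range \<sigma> \<subseteq> T \<and>
      limitin (ip_topology X ipX) (fst \<circ> \<sigma>) x sequentially \<and>
      limitin (ip_topology Y ipY) (snd \<circ> \<sigma>) y sequentially \<longrightarrow> (x, y) \<in> T)"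
    by (simp add: top[symmetric] limitin_pairwise)
  also have "\<dots> \<longleftrightarrow> ?R"
  proof safe
    fix \<xi> \<eta> x y
    assume "\<forall>\<sigma> x y. range \<sigma> \<subseteq> T \<and>
      limitin (ip_topology X ipX) (fst \<circ> \<sigma>) x sequentially \<and>
      limitin (ip_topology Y ipY) (snd \<circ> \<sigma>) y sequentially \<longrightarrow> (x, y) \<in> T"
      and "\<forall>n. (\<xi> n, \<eta> n) \<in> T" "limitin (ip_topology X ipX) \<xi> x sequentially"
      "limitin (ip_topology Y ipY) \<eta> y sequentially"
    then show "(x, y) \<in> T"
      by (elim allE[of _ "\<lambda>n. (\<xi> n, \<eta> n)"]) (auto simp: o_def)
  next
    fix \<sigma> :: "nat \<Rightarrow> 'a \<times> 'b" and x y
    assume R: ?R and \<sigma>: "range \<sigma> \<subseteq> T"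
      and lim: "limitin (ip_topology X ipX) (fst \<circ> \<sigma>) x sequentially"
      "limitin (ip_topology Y ipY) (snd \<circ> \<sigma>) y sequentially"
    have "\<forall>n. ((fst \<circ> \<sigma>) n, (snd \<circ> \<sigma>) n) \<in> T" using \<sigma> by auto
    then show "(x, y) \<in> T" using R lim by blast
  qed
  finally show ?thesis by (simp only: top)
qed

lemma closed_imp_multivalued_part_closed:
  assumes "closedin (prod_topology (ip_topology X ipX) (ip_topology Y ipY)) T"
  shows "closedin (ip_topology Y ipY) (T `` {0})"
proof -
  have "y \<in> T `` {0}"
    if "range \<eta> \<subseteq> T `` {0}" "limitin (ip_topology Y ipY) \<eta> y sequentially" for \<eta> y
  proof -
    have "limitin (ip_topology X ipX) (\<lambda>_::nat. 0) 0 sequentially"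
      using dom.subspace_0[OF dom.subspace_carrier]
      by (simp add: limitin_const ip_topology_def)
    moreover have "\<forall>n. (0, \<eta> n) \<in> T" using that(1) by auto
    ultimately have "(0, y) \<in> T"
      using assms[unfolded closedin_relation, rule_format, of "\<lambda>_. 0" \<eta> 0 y] that(2) by simp
    then show ?thesis by simp
  qed
  moreover have "T `` {0} \<subseteq> Y" using T_in by auto
  ultimately show ?thesis unfolding cod.closedin_ip_topology by blast
qed

end

text \<open>Since \<open>T(0)\<close> equals its closure here, the quotient in which the cosets \<open>T(x)\<close> are compared is
  \<open>Y/T(0)\<close> itself, and the component of \<open>T(x)\<close> orthogonal to \<open>T(0)\<close> lies again in \<open>T(x)\<close>.\<close>

locale hilbert_relation_closed_at_0 = hilbert_relation sX X ipX sY Y ipY T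
  for sX :: "'k::real_or_complex \<Rightarrow> 'a::ab_group_add \<Rightarrow> 'a" and X ipX
    and sY :: "'k \<Rightarrow> 'b::ab_group_add \<Rightarrow> 'b" and Y ipY T +
  assumes closed_at_0: "closedin (ip_topology Y ipY) (T `` {0})"
begin

text \<open>The choice of \<open>y\<close> is immaterial (\<open>perp_part_eq_operator_part\<close>).\<close>

definition operator_part :: "'a \<Rightarrow> 'b" where
  "operator_part x = perp_part Y ipY (T `` {0}) (SOME y. (x, y) \<in> T)"

abbreviation "perp0 \<equiv> orth_complement Y ipY (T `` {0})"

lemma multivalued_part_in: "T `` {0} \<subseteq> Y"
  using T_in by auto

lemma operator_part:
  assumes "x \<in> Domain T"
  shows "(x, operator_part x) \<in> T" "operator_part x \<in> perp0"
proof -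
  let ?y = "SOME y. (x, y) \<in> T"
  have y: "(x, ?y) \<in> T" using assms by (auto intro: someI)
  note pp = cod.perp_part[OF closed_at_0 multivalued_part_subspace T_in(2)[OF y]]
  show "operator_part x \<in> perp0" using pp(1) by (simp add: operator_part_def)
  show "(x, operator_part x) \<in> T"
    using T_diff[OF y, of 0 "?y - operator_part x"] pp(2) by (simp add: operator_part_def)
qed

lemma operator_part_in:
  assumes "x \<in> Domain T"
  shows "x \<in> X" "operator_part x \<in> Y"
  using T_in[OF operator_part(1)[OF assms]] by auto

lemma perp_part_eq_operator_part:
  assumes "(x, y) \<in> T"
  shows "perp_part Y ipY (T `` {0}) y = operator_part x"
proof (rule cod.perp_part_eqI[OF multivalued_part_in multivalued_part_subspace])
  have x: "x \<in> Domain T" using assms by auto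
  show "operator_part x \<in> perp0" by (rule operator_part(2)[OF x])
  show "y - operator_part x \<in> T `` {0}"
    using T_diff[OF assms operator_part(1)[OF x]] by simp
qed

lemma operator_part_unique:
  assumes "(x, w) \<in> T" "w \<in> perp0"
  shows "operator_part x = w"
  using perp_part_eq_operator_part[OF assms(1)] T_zero
    cod.perp_part_eqI[OF multivalued_part_in multivalued_part_subspace assms(2), of w]
  by simp

lemma operator_part_linear:
  assumes "x \<in> Domain T" "x' \<in> Domain T"
  shows "operator_part (x + x') = operator_part x + operator_part x'"
    "operator_part (x - x') = operator_part x - operator_part x'"
    "operator_part (sX c x) = sY c (operator_part x)"
proof -
  note sub = cod.orth_complement_subspace[OF multivalued_part_in]
  show "operator_part (x + x') = operator_part x + operator_part x'"
    using assms by (intro operator_part_unique T_add cod.subspace_add[OF sub] operator_part)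
  show "operator_part (x - x') = operator_part x - operator_part x'"
    using assms by (intro operator_part_unique T_diff cod.subspace_diff[OF sub] operator_part)
  show "operator_part (sX c x) = sY c (operator_part x)"
    using assms by (intro operator_part_unique T_scale cod.subspace_scale[OF sub] operator_part)
qed

text \<open>By Pythagoras, the operator part picks the shortest element of each \<open>T(x)\<close>.\<close>

lemma operator_part_norm_le:
  assumes "(x, y) \<in> T"
  shows "ip_norm ipY (operator_part x) \<le> ip_norm ipY y"
proof -
  have x: "x \<in> Domain T" using assms by auto
  let ?w = "operator_part x"
  have d: "y - ?w \<in> T `` {0}"
    using T_diff[OF assms operator_part(1)[OF x]] by simp
  have "ipY ?w (y - ?w) = 0"
    using operator_part(2)[OF x] d by (auto simp: orth_complement_def)
  then have "(ip_norm ipY (?w + (y - ?w)))\<^sup>2 = (ip_norm ipY ?w)\<^sup>2 + (ip_norm ipY (y - ?w))\<^sup>2"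
    using operator_part_in[OF x] d multivalued_part_in by (intro cod.Pythagoras) auto
  then have "(ip_norm ipY ?w)\<^sup>2 \<le> (ip_norm ipY y)\<^sup>2" by simp
  then show ?thesis using cod.ip_norm_nonneg by (rule power2_le_imp_le)
qed

section \<open>The graph inner product\<close>

text \<open>All elements of \<open>T(x)\<close> have \<open>operator_part x\<close> as their component orthogonal to \<open>T(0)\<close>, so
  the inner product of two cosets does not depend on the representatives and its definite
  description denotes.\<close>

lemma relation_ip_eq:
  assumes "x1 \<in> Domain T" "x2 \<in> Domain T"
  shows "relation_ip Y ipY T x1 x2 = ipY (operator_part x1) (operator_part x2)"
proof -
  have q: "quotient_ip Y ipY (T `` {0}) (coset (T `` {0}) y1) (coset (T `` {0}) y2)
      = ipY (operator_part x1) (operator_part x2)" if "(x1, y1) \<in> T" "(x2, y2) \<in> T" for y1 y2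
    using cod.quotient_ip_coset[OF closed_at_0 multivalued_part_subspace] T_in that
    by (simp add: perp_part_eq_operator_part)
  show ?thesis
    unfolding relation_ip_def closure_of_closedin[OF closed_at_0] Let_def
    by (rule the_equality) (use q operator_part(1)[OF assms(1)] operator_part(1)[OF assms(2)] in auto)
qed

lemma graph_ip_eq:
  assumes "x1 \<in> Domain T" "x2 \<in> Domain T"
  shows "graph_ip ipX Y ipY T x1 x2 = ipX x1 x2 + ipY (operator_part x1) (operator_part x2)"
  using relation_ip_eq[OF assms] by (simp add: graph_ip_def)

lemma graph_ip_self:
  assumes "x \<in> Domain T"
  shows "graph_ip ipX Y ipY T x x
    = of_real ((ip_norm ipX x)\<^sup>2 + (ip_norm ipY (operator_part x))\<^sup>2)"
  using graph_ip_eq[OF assms assms] dom.ip_self cod.ip_self operator_part_in[OF assms]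
  by simp

lemma graph_norm:
  assumes "x \<in> Domain T"
  shows "ip_norm (graph_ip ipX Y ipY T) x
    = sqrt ((ip_norm ipX x)\<^sup>2 + (ip_norm ipY (operator_part x))\<^sup>2)"
  unfolding ip_norm_def[of "graph_ip ipX Y ipY T"] graph_ip_self[OF assms] norm_of_real by simp

lemma inner_product_space_graph_ip:
  "inner_product_space sX (Domain T) (graph_ip ipX Y ipY T)"
proof
  note D = Domain_subspace
  let ?S = operator_part and ?G = "graph_ip ipX Y ipY T"
  show "dom.subspace (Domain T)" by (rule D)
  show "?G (x + y) z = ?G x z + ?G y z" if "x \<in> Domain T" "y \<in> Domain T" "z \<in> Domain T" for x y z
    using that dom.subspace_add[OF D that(1,2)]
    by (simp add: graph_ip_eq operator_part_linear operator_part_in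
        dom.ip_add_left cod.ip_add_left)
  show "?G (sX c x) y = c * ?G x y" if "x \<in> Domain T" "y \<in> Domain T" for x y c
    using that dom.subspace_scale[OF D that(1)]
    by (simp add: graph_ip_eq operator_part_linear operator_part_in
        dom.ip_scale_left cod.ip_scale_left distrib_left)
  show "?G x y = cj (?G y x)" if "x \<in> Domain T" "y \<in> Domain T" for x y
    using that dom.ip_commute[of x y] cod.ip_commute[of "?S x" "?S y"]
    by (simp add: graph_ip_eq operator_part_in cj_add)
  show "?G x x \<in> \<real>\<^sub>\<ge>\<^sub>0" if "x \<in> Domain T" for x
    unfolding graph_ip_self[OF that] nonneg_Reals_of_real_iff by simp
  show "x = 0" if "x \<in> Domain T" "?G x x = 0" for x
  proof -
    have "(ip_norm ipX x)\<^sup>2 + (ip_norm ipY (?S x))\<^sup>2 = 0"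
      using that graph_ip_self[OF that(1)] of_real_eq_0_iff by metis
    then have "ip_norm ipX x = 0" by (simp add: sum_power2_eq_zero_iff)
    then show ?thesis using dom.ip_norm_eq_0 operator_part_in(1)[OF that(1)] by blast
  qed
qed

sublocale graph: inner_product_space sX "Domain T" "graph_ip ipX Y ipY T"
  by (rule inner_product_space_graph_ip)

lemma graph_norm_bounds:
  assumes "x \<in> Domain T"
  shows "ip_norm ipX x \<le> ip_norm (graph_ip ipX Y ipY T) x"
    "ip_norm ipY (operator_part x) \<le> ip_norm (graph_ip ipX Y ipY T) x"
    "ip_norm (graph_ip ipX Y ipY T) x \<le> ip_norm ipX x + ip_norm ipY (operator_part x)"
  unfolding graph_norm[OF assms]
  by (auto intro!: real_le_rsqrt sqrt_sum_squares_le_sum dom.ip_norm_nonneg cod.ip_norm_nonneg)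

text \<open>By \<open>graph_norm_bounds\<close>, \<open>x \<mapsto> (x, operator_part x)\<close> identifies the graph inner product space
  with the operator part of \<open>T\<close> as a subspace of \<open>X \<times> Y\<close>, as far as limits are concerned.\<close>

lemma limitin_graph:
  assumes "\<And>n. \<xi> n \<in> Domain T"
  shows "limitin (ip_topology (Domain T) (graph_ip ipX Y ipY T)) \<xi> x sequentially \<longleftrightarrow>
    x \<in> Domain T \<and> limitin (ip_topology X ipX) \<xi> x sequentially \<and>
    limitin (ip_topology Y ipY) (\<lambda>n. operator_part (\<xi> n)) (operator_part x) sequentially"
proof (cases "x \<in> Domain T")
  case True
  let ?G = "ip_norm (graph_ip ipX Y ipY T)"
  have d: "\<xi> n - x \<in> Domain T" for n
    using assms True Domain_subspace dom.subspace_diff by blast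
  have S: "operator_part (\<xi> n - x) = operator_part (\<xi> n) - operator_part x" for n
    using assms True by (rule operator_part_linear)
  note b = graph_norm_bounds[OF d, unfolded S]
  have "(\<lambda>n. ?G (\<xi> n - x)) \<longlonglongrightarrow> 0 \<longleftrightarrow>
      (\<lambda>n. ip_norm ipX (\<xi> n - x)) \<longlonglongrightarrow> 0 \<and>
      (\<lambda>n. ip_norm ipY (operator_part (\<xi> n) - operator_part x)) \<longlonglongrightarrow> 0"
  proof (intro iffI conjI; (elim conjE)?)
    assume G: "(\<lambda>n. ?G (\<xi> n - x)) \<longlonglongrightarrow> 0"
    show "(\<lambda>n. ip_norm ipX (\<xi> n - x)) \<longlonglongrightarrow> 0"
      by (rule real_tendsto_sandwich[OF _ _ tendsto_const G]) (auto simp: b dom.ip_norm_nonneg)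
    show "(\<lambda>n. ip_norm ipY (operator_part (\<xi> n) - operator_part x)) \<longlonglongrightarrow> 0"
      by (rule real_tendsto_sandwich[OF _ _ tendsto_const G]) (auto simp: b cod.ip_norm_nonneg)
  next
    assume "(\<lambda>n. ip_norm ipX (\<xi> n - x)) \<longlonglongrightarrow> 0"
      "(\<lambda>n. ip_norm ipY (operator_part (\<xi> n) - operator_part x)) \<longlonglongrightarrow> 0"
    from tendsto_add[OF this]
    have sum: "(\<lambda>n. ip_norm ipX (\<xi> n - x) + ip_norm ipY (operator_part (\<xi> n) - operator_part x))
        \<longlonglongrightarrow> 0" by simp
    show "(\<lambda>n. ?G (\<xi> n - x)) \<longlonglongrightarrow> 0"
      by (rule real_tendsto_sandwich[OF _ _ tendsto_const sum]) (auto simp: b graph.ip_norm_nonneg)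
  qed
  then show ?thesis
    using True assms operator_part_in
    by (simp add: graph.limitin_ip_topology dom.limitin_ip_topology cod.limitin_ip_topology)
qed (simp add: graph.limitin_ip_topology)

text \<open>The same holds for Cauchy sequences, again by \<open>graph_norm_bounds\<close>, now for the differences of
  members.\<close>

lemma MCauchy_graph:
  "graph.metric.MCauchy \<xi> \<longleftrightarrow> range \<xi> \<subseteq> Domain T \<and> dom.metric.MCauchy \<xi> \<and>
    cod.metric.MCauchy (\<lambda>n. operator_part (\<xi> n))" (is "?L \<longleftrightarrow> ?R")
proof (cases "range \<xi> \<subseteq> Domain T")
  case True
  then have \<xi>: "\<xi> n \<in> Domain T" for n by auto
  have d: "\<xi> m - \<xi> n \<in> Domain T" for m n
    using \<xi> Domain_subspace dom.subspace_diff by blast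
  have S: "operator_part (\<xi> m - \<xi> n) = operator_part (\<xi> m) - operator_part (\<xi> n)" for m n
    using \<xi> \<xi> by (rule operator_part_linear)
  note b = graph_norm_bounds[OF d, unfolded S]
  have inXY: "range \<xi> \<subseteq> X" "range (\<lambda>n. operator_part (\<xi> n)) \<subseteq> Y"
    using \<xi> operator_part_in by auto
  show ?thesis
  proof
    assume ?L
    then have G: "\<forall>\<epsilon>>0. \<exists>N. \<forall>m n. N \<le> m \<longrightarrow> N \<le> n \<longrightarrow>
        ip_norm (graph_ip ipX Y ipY T) (\<xi> m - \<xi> n) < \<epsilon>"
      unfolding graph.MCauchy_ip by (rule conjunct2)
    show ?R
      unfolding dom.MCauchy_ip cod.MCauchy_ip
      by (intro conjI True inXY Cauchy_estimate_mono[OF G] b(1,2))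
  next
    assume R: ?R
    show ?L
      unfolding graph.MCauchy_ip
    proof (intro conjI True allI impI)
      fix \<epsilon> :: real assume "0 < \<epsilon>"
      then have "0 < \<epsilon> / 2" by simp
      with R obtain N1 N2 where
        1: "\<And>m n. N1 \<le> m \<Longrightarrow> N1 \<le> n \<Longrightarrow> ip_norm ipX (\<xi> m - \<xi> n) < \<epsilon> / 2" and
        2: "\<And>m n. N2 \<le> m \<Longrightarrow> N2 \<le> n \<Longrightarrow>
          ip_norm ipY (operator_part (\<xi> m) - operator_part (\<xi> n)) < \<epsilon> / 2"
        unfolding dom.MCauchy_ip cod.MCauchy_ip by metis
      have "ip_norm (graph_ip ipX Y ipY T) (\<xi> m - \<xi> n) < \<epsilon>"
        if "max N1 N2 \<le> m" "max N1 N2 \<le> n" for m n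
        using b(3)[of m n] 1[of m n] 2[of m n] that by simp
      then show "\<exists>N. \<forall>m n. N \<le> m \<longrightarrow> N \<le> n \<longrightarrow>
          ip_norm (graph_ip ipX Y ipY T) (\<xi> m - \<xi> n) < \<epsilon>" by blast
    qed
  qed
qed (simp add: graph.MCauchy_ip)

section \<open>Closedness and completeness\<close>

text \<open>The limit \<open>w\<close> of the operator parts is in \<open>T(x)\<close> by closedness. That it can be replaced by
  \<open>operator_part x\<close> follows from minimality of the operator part of \<open>\<xi> n - x\<close>.\<close>

lemma closed_imp_hilbert:
  assumes closed: "closedin (prod_topology (ip_topology X ipX) (ip_topology Y ipY)) T"
  shows "hilbert_space sX (Domain T) (graph_ip ipX Y ipY T)"
proof
  show "graph.metric.mcomplete"
    unfolding graph.metric.mcomplete_def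
  proof (intro allI impI)
    fix \<xi> assume "graph.metric.MCauchy \<xi>"
    then have \<xi>: "\<xi> n \<in> Domain T" and C: "dom.metric.MCauchy \<xi>"
      "cod.metric.MCauchy (\<lambda>n. operator_part (\<xi> n))" for n
      unfolding MCauchy_graph by auto
    obtain x where x: "limitin (ip_topology X ipX) \<xi> x sequentially"
      using C(1) dom.complete unfolding dom.metric.mcomplete_def ip_topology_def by blast
    obtain w where w: "limitin (ip_topology Y ipY) (\<lambda>n. operator_part (\<xi> n)) w sequentially"
      using C(2) cod.complete unfolding cod.metric.mcomplete_def ip_topology_def by blast
    have xw: "(x, w) \<in> T"
      using closed[unfolded closedin_relation, rule_format, of \<xi> "\<lambda>n. operator_part (\<xi> n)" x w]
        x w operator_part(1)[OF \<xi>] by simp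
    then have xD: "x \<in> Domain T" by auto
    have le: "ip_norm ipY (operator_part (\<xi> n) - operator_part x)
        \<le> ip_norm ipY (operator_part (\<xi> n) - w)" for n
      using operator_part_norm_le[OF T_diff[OF operator_part(1)[OF \<xi>] xw]]
      by (simp add: operator_part_linear \<xi> xD)
    have w0: "(\<lambda>n. ip_norm ipY (operator_part (\<xi> n) - w)) \<longlonglongrightarrow> 0"
      using w by (simp add: cod.limitin_ip_topology)
    have "(\<lambda>n. ip_norm ipY (operator_part (\<xi> n) - operator_part x)) \<longlonglongrightarrow> 0"
      by (rule real_tendsto_sandwich[OF _ _ tendsto_const w0]) (auto simp: le cod.ip_norm_nonneg)
    then have "limitin (ip_topology Y ipY) (\<lambda>n. operator_part (\<xi> n)) (operator_part x) sequentially"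
      by (simp add: cod.limitin_ip_topology operator_part_in \<xi> xD)
    then show "\<exists>x. limitin graph.metric.mtopology \<xi> x sequentially"
      using limitin_graph[of \<xi> x] \<xi> xD x unfolding ip_topology_def by blast
  qed
qed

text \<open>The second components of a convergent sequence in \<open>T\<close> need not be operator parts, but by
  minimality the operator parts vary no more than they do, so the first components converge in the
  graph norm. What is left over in the second components stays in the closed space \<open>T(0)\<close>.\<close>

lemma hilbert_imp_closed:
  assumes "hilbert_space sX (Domain T) (graph_ip ipX Y ipY T)"
  shows "closedin (prod_topology (ip_topology X ipX) (ip_topology Y ipY)) T"
  unfolding closedin_relation
proof (intro allI impI, elim conjE)
  fix \<xi> \<eta> x y
  assume T: "\<forall>n. (\<xi> n, \<eta> n) \<in> T"
    and x: "limitin (ip_topology X ipX) \<xi> x sequentially"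
    and y: "limitin (ip_topology Y ipY) \<eta> y sequentially"
  have \<xi>: "\<xi> n \<in> Domain T" for n using T by auto
  have CX: "dom.metric.MCauchy \<xi>"
    using x T_in(1)[OF T[rule_format]]
    by (intro dom.metric.convergent_imp_MCauchy) (auto simp: ip_topology_def)
  have "cod.metric.MCauchy \<eta>"
    using y T_in(2)[OF T[rule_format]]
    by (intro cod.metric.convergent_imp_MCauchy) (auto simp: ip_topology_def)
  then have C\<eta>: "\<forall>\<epsilon>>0. \<exists>N. \<forall>m n. N \<le> m \<longrightarrow> N \<le> n \<longrightarrow> ip_norm ipY (\<eta> m - \<eta> n) < \<epsilon>"
    unfolding cod.MCauchy_ip by (rule conjunct2)
  have le: "ip_norm ipY (operator_part (\<xi> m) - operator_part (\<xi> n))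
      \<le> ip_norm ipY (\<eta> m - \<eta> n)" for m n
    using operator_part_norm_le[OF T_diff[OF T[rule_format] T[rule_format]], of m n]
    by (simp add: operator_part_linear \<xi>)
  have "range (\<lambda>n. operator_part (\<xi> n)) \<subseteq> Y" using operator_part_in \<xi> by auto
  then have "cod.metric.MCauchy (\<lambda>n. operator_part (\<xi> n))"
    unfolding cod.MCauchy_ip using Cauchy_estimate_mono[OF C\<eta> le] by (rule conjI)
  then have "graph.metric.MCauchy \<xi>"
    unfolding MCauchy_graph using CX \<xi> by auto
  then obtain x' where "limitin (ip_topology (Domain T) (graph_ip ipX Y ipY T)) \<xi> x' sequentially"
    using hilbert_space.complete[OF assms]
    unfolding graph.metric.mcomplete_def ip_topology_def by blast
  then have x': "x' \<in> Domain T" "limitin (ip_topology X ipX) \<xi> x' sequentially"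
    and S: "limitin (ip_topology Y ipY) (\<lambda>n. operator_part (\<xi> n)) (operator_part x') sequentially"
    using limitin_graph \<xi> by blast+
  have "x' = x"
    using x x'(2) dom.metric.limitin_metric_unique trivial_limit_sequentially
    unfolding ip_topology_def by blast
  have Sx: "operator_part x' \<in> Y" and yY: "y \<in> Y"
    using operator_part_in x'(1) y by (auto simp: cod.limitin_ip_topology)
  have r: "\<eta> n - operator_part (\<xi> n) \<in> T `` {0}" for n
    using T_diff[OF _ operator_part(1)[OF \<xi>], of "\<xi> n" "\<eta> n" n] T by simp
  have lim: "limitin (ip_topology Y ipY) (\<lambda>n. \<eta> n - operator_part (\<xi> n))
      (y - operator_part x') sequentially"
  proof -
    have sum: "(\<lambda>n. ip_norm ipY (\<eta> n - y) + ip_norm ipY (operator_part (\<xi> n) - operator_part x'))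
        \<longlonglongrightarrow> 0"
      by (rule tendsto_add_zero) (use y S in \<open>simp_all add: cod.limitin_ip_topology\<close>)
    have le: "ip_norm ipY (\<eta> n - operator_part (\<xi> n) - (y - operator_part x'))
        \<le> ip_norm ipY (\<eta> n - y) + ip_norm ipY (operator_part (\<xi> n) - operator_part x')" for n
    proof -
      have a: "\<eta> n - y \<in> Y" and b: "operator_part x' - operator_part (\<xi> n) \<in> Y"
        using T T_in Sx yY operator_part_in \<xi> cod.subspace_diff[OF cod.subspace_carrier] by blast+
      have e: "\<eta> n - operator_part (\<xi> n) - (y - operator_part x')
          = (\<eta> n - y) + (operator_part x' - operator_part (\<xi> n))" by simp
      show ?thesis
        unfolding e using cod.ip_norm_triangle[OF a b]
          cod.ip_norm_minus_commute[OF Sx operator_part_in(2)[OF \<xi>]] by metis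
    qed
    have "(\<lambda>n. ip_norm ipY (\<eta> n - operator_part (\<xi> n) - (y - operator_part x'))) \<longlonglongrightarrow> 0"
      by (rule real_tendsto_sandwich[OF _ _ tendsto_const sum]) (auto simp: le cod.ip_norm_nonneg)
    moreover have "y - operator_part x' \<in> Y"
      using Sx yY cod.subspace_diff[OF cod.subspace_carrier] by blast
    moreover have "\<eta> n - operator_part (\<xi> n) \<in> Y" for n
      using r multivalued_part_in by blast
    ultimately show ?thesis by (simp add: cod.limitin_ip_topology)
  qed
  have "y - operator_part x' \<in> T `` {0}"
    by (rule limitin_closedin[OF lim closed_at_0]) (use r in auto)
  then have "(0, y - operator_part x') \<in> T" by simp
  from T_add[OF operator_part(1)[OF x'(1)] this] show "(x, y) \<in> T"
    using \<open>x' = x\<close> by simp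
qed

end

theorem theorem4p3:
  fixes sX :: "'k::real_or_complex \<Rightarrow> 'a::ab_group_add \<Rightarrow> 'a"
    and X :: "'a set" and ipX :: "'a \<Rightarrow> 'a \<Rightarrow> 'k"
    and sY :: "'k \<Rightarrow> 'b::ab_group_add \<Rightarrow> 'b"
    and Y :: "'b set" and ipY :: "'b \<Rightarrow> 'b \<Rightarrow> 'k"
    and T :: "('a \<times> 'b) set"
  assumes "hilbert_space sX X ipX"
    and "hilbert_space sY Y ipY"
    and "T \<in> linear_relations sX X sY Y"
  shows "closedin (prod_topology (ip_topology X ipX) (ip_topology Y ipY)) T \<longleftrightarrow>
    hilbert_space sX (Domain T) (graph_ip ipX Y ipY T) \<and>
    closedin (ip_topology Y ipY) (T `` {0})"
proof -
  interpret hilbert_relation sX X ipX sY Y ipY T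
    using assms by (simp add: hilbert_relation_def hilbert_relation_axioms_def)
  have closed_at_0: "hilbert_relation_closed_at_0 sX X ipX sY Y ipY T"
    if "closedin (ip_topology Y ipY) (T `` {0})"
    using that by unfold_locales
  show ?thesis
    using closed_imp_multivalued_part_closed
      hilbert_relation_closed_at_0.closed_imp_hilbert[OF closed_at_0]
      hilbert_relation_closed_at_0.hilbert_imp_closed[OF closed_at_0] by blast
qed

end
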